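(* The limit of $\frac{1}{1+qx}\,\mathcal{S}$ at $x=-1/q$ is the tree series $\overline{\Omega}_q$.
   Context: $q$ and $x$ are indeterminates. A tree is a finite rooted tree (finite connected acyclic graph with a distinguished vertex, the root), considered up to isomorphism. $\#T$ is the number of vertices of $T$, $\mathrm{aut}(T)$ is the order of its automorphism group, $\bullet$ is the one-vertex tree, and $B_+(T_1,\dots,T_k)$ is the tree obtained by grafting $T_1,\dots,T_k$ on a new common root. A tree series over a commutative $\mathbb{Q}$-algebra $R$ is a formal infinite sum $A=\sum_T A_T\,\frac{T}{\mathrm{aut}(T)}$ over all trees, with $A_T\in R$; $\bullet$ is also viewed as a tree series. For $\alpha\in R$, $(\Sigma_\alpha A)_T=\alpha^{\#T-1}A_T$. For tree series $A,B$, the tree series $\mathrm{Crls}\diamond(A,B)$ is defined by $$(\mathrm{Crls}\diamond(A,B))_T=\sum_{T_0}A_{T_0}\prod_{T'}B_{T'},$$ where $T_0$ runs over the subtrees (connected sets of vertices) of $T$ containing the root of $T$ (and rooted there), and $T'$ runs over the connected components of the complement of $T_0$ in $T$, each rooted at its vertex closest to the root of $T$ (an empty product is $1$). $\mathcal{S}$ denotes the unique tree series over $\mathbb{Q}(q)[x]$ satisfying $$q\,\Sigma_q \mathcal{S}-\mathrm{Crls}\diamond(\mathcal{S},-\bullet)=q\,(1+(q-1)x)\,\mathrm{Crls}\diamond(\bullet,\,q\,\Sigma_q \mathcal{S})-\bullet .$$ Every coefficient $\mathcal{S}_T$ is divisible by $1+qx$ in $\mathbb{Q}(q)[x]$; the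 limit at $x=-1/q$ is taken coefficientwise, i.e. one evaluates the polynomial $\mathcal{S}_T/(1+qx)$ at $x=-1/q$. $\bullet\curvearrowleft A$ denotes the grafting of $A$ on the one-vertex tree (pre-Lie product): the coefficient of $B_+(T_1)$ in it is $A_{T_1}$, and the coefficient of any tree not of the form $B_+(T_1)$ is $0$. $\Omega_q$ is the tree series over $\mathbb{Q}(q)$ defined by the equation (which determines it uniquely) $$\mathrm{Crls}\diamond(q\,\Sigma_q\Omega_q,\bullet)-\Omega_q=\bullet\curvearrowleft\Omega_q+(q-1)\bullet ,$$ $\Omega_{1/q}$ is obtained from it by replacing $q$ by $1/q$ in all coefficients, and $\overline{\Omega}_q=\Sigma_{(-1/q)}\Omega_{1/q}$. *)

theory Defs
  imports
    "HOL-Computational_Algebra.Computational_Algebra"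
    "HOL-Computational_Algebra.Field_as_Ring"
begin

section \<open>Finite rooted trees up to isomorphism\<close>

text \<open>Concrete rooted graphs have vertices in \<^typ>\<open>nat\<close>, which loses no isomorphism class of
  finite trees. An edge is a two-element set of vertices.\<close>

datatype rgraph = RGraph (verts: "nat set") (edges: "nat set set") (root: nat)

text \<open>Adjacency inside a set \<open>W\<close> of vertices.\<close>

definition adj :: "nat set set \<Rightarrow> nat set \<Rightarrow> (nat \<times> nat) set" where
  "adj E W = {(u, v). u \<in> W \<and> v \<in> W \<and> {u, v} \<in> E}"

definition connected_in :: "nat set set \<Rightarrow> nat set \<Rightarrow> bool" where
  "connected_in E W \<longleftrightarrow> (\<forall>u\<in>W. \<forall>v\<in>W. (u, v) \<in> (adj E W)\<^sup>*)"

definition is_cycle :: "nat set set \<Rightarrow> nat list \<Rightarrow> bool" where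
  "is_cycle E vs \<longleftrightarrow> 3 \<le> length vs \<and> distinct vs \<and>
     (\<forall>i < length vs. {vs ! i, vs ! (Suc i mod length vs)} \<in> E)"

definition is_rtree :: "rgraph \<Rightarrow> bool" where
  "is_rtree G \<longleftrightarrow>
     finite (verts G) \<and> root G \<in> verts G \<and>
     (\<forall>e \<in> edges G. \<exists>u v. u \<in> verts G \<and> v \<in> verts G \<and> u \<noteq> v \<and> e = {u, v}) \<and>
     connected_in (edges G) (verts G) \<and> (\<nexists>vs. is_cycle (edges G) vs)"

definition rgraph_iso :: "(nat \<Rightarrow> nat) \<Rightarrow> rgraph \<Rightarrow> rgraph \<Rightarrow> bool" where
  "rgraph_iso f G H \<longleftrightarrow> bij_betw f (verts G) (verts H) \<and>
     (\<forall>u \<in> verts G. \<forall>v \<in> verts G. {f u, f v} \<in> edges H \<longleftrightarrow> {u, v} \<in> edges G) \<and>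
     f (root G) = root H"

definition rtree_equiv :: "rgraph \<Rightarrow> rgraph \<Rightarrow> bool" where
  "rtree_equiv G H \<longleftrightarrow> is_rtree G \<and> is_rtree H \<and> (\<exists>f. rgraph_iso f G H)"

lemma rgraph_iso_inv:
  assumes "rgraph_iso f G H" and "root G \<in> verts G"
  shows "rgraph_iso (inv_into (verts G) f) H G"
proof -
  let ?g = "inv_into (verts G) f"
  have b: "bij_betw f (verts G) (verts H)" using assms by (simp add: rgraph_iso_def)
  have g: "?g u \<in> verts G" "f (?g u) = u" if "u \<in> verts H" for u
    using b that by (auto simp: bij_betw_def inv_into_into f_inv_into_f)
  have "{?g u, ?g v} \<in> edges G \<longleftrightarrow> {u, v} \<in> edges H" if "u \<in> verts H" "v \<in> verts H" for u v
    using assms(1) g[OF that(1)] g[OF that(2)] unfolding rgraph_iso_def by metis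
  moreover have "?g (root H) = root G"
    using assms b by (metis rgraph_iso_def bij_betw_inv_into_left)
  ultimately show ?thesis
    using bij_betw_inv_into[OF b] by (simp add: rgraph_iso_def)
qed

lemma rgraph_iso_comp:
  assumes "rgraph_iso f G H" "rgraph_iso g H K"
  shows "rgraph_iso (g \<circ> f) G K"
proof -
  have "f u \<in> verts H" if "u \<in> verts G" for u
    using assms(1) that by (auto simp: rgraph_iso_def bij_betw_def)
  then show ?thesis
    using assms by (auto simp: rgraph_iso_def intro: bij_betw_trans)
qed

quotient_type tree = rgraph / partial: rtree_equiv
proof (rule part_equivpI)
  have "is_rtree (RGraph {0} {} 0)"
    by (auto simp: is_rtree_def connected_in_def is_cycle_def intro!: exI[of _ 0])
  moreover have "rgraph_iso id (RGraph {0} {} 0) (RGraph {0} {} 0)"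
    by (simp add: rgraph_iso_def)
  ultimately show "\<exists>G. rtree_equiv G G"
    unfolding rtree_equiv_def by blast
  show "symp rtree_equiv"
    unfolding symp_def rtree_equiv_def using rgraph_iso_inv is_rtree_def by blast
  show "transp rtree_equiv"
    unfolding transp_def rtree_equiv_def using rgraph_iso_comp by blast
qed

text \<open>The functions below are computed on the representative \<^term>\<open>rep_tree T\<close>; all of them are
  invariant under isomorphism.\<close>

definition tree_size :: "tree \<Rightarrow> nat" where
  "tree_size T = card (verts (rep_tree T))"

definition one_tree :: tree where
  "one_tree = abs_tree (RGraph {0} {} 0)"

text \<open>\<open>B\<^sub>+(T)\<close> for a single tree: the old vertices are shifted by one and \<open>0\<close> is the new root.\<close>

definition Bplus1 :: "tree \<Rightarrow> tree" where
  "Bplus1 T = (let G = rep_tree T in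
     abs_tree (RGraph (insert 0 (Suc ` verts G)) (insert {0, Suc (root G)} ((`) Suc ` edges G)) 0))"

definition induced :: "rgraph \<Rightarrow> nat set \<Rightarrow> nat \<Rightarrow> rgraph" where
  "induced G W r = RGraph W {e \<in> edges G. e \<subseteq> W} r"

definition root_subtrees :: "rgraph \<Rightarrow> nat set set" where
  "root_subtrees G = {W. W \<subseteq> verts G \<and> root G \<in> W \<and> connected_in (edges G) W}"

definition components_in :: "nat set set \<Rightarrow> nat set \<Rightarrow> nat set set" where
  "components_in E W = {{v \<in> W. (u, v) \<in> (adj E W)\<^sup>*} | u. u \<in> W}"

definition root_dist :: "rgraph \<Rightarrow> nat \<Rightarrow> nat" where
  "root_dist G v = (LEAST n. (root G, v) \<in> adj (edges G) (verts G) ^^ n)"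

definition closest :: "rgraph \<Rightarrow> nat set \<Rightarrow> nat" where
  "closest G C = arg_min_on (root_dist G) C"


section \<open>Tree series\<close>

text \<open>A tree series is the family of its coefficients \<open>A\<^sub>T\<close> with respect to \<open>T / aut(T)\<close>. Since
  \<open>aut(\<bullet>) = 1\<close>, the one-vertex tree has coefficient \<open>1\<close> at itself.\<close>

type_synonym 'a tree_series = "tree \<Rightarrow> 'a"

definition bullet :: "'a::comm_ring_1 tree_series" where
  "bullet T = (if T = one_tree then 1 else 0)"

definition smul :: "'a::comm_ring_1 \<Rightarrow> 'a tree_series \<Rightarrow> 'a tree_series" where
  "smul c A = (\<lambda>T. c * A T)"

definition Susp :: "'a::comm_ring_1 \<Rightarrow> 'a tree_series \<Rightarrow> 'a tree_series" where
  "Susp \<alpha> A = (\<lambda>T. \<alpha> ^ (tree_size T - 1) * A T)"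

definition Crls :: "'a::comm_ring_1 tree_series \<Rightarrow> 'a tree_series \<Rightarrow> 'a tree_series" where
  "Crls A B = (\<lambda>T. let G = rep_tree T in
     \<Sum>W \<in> root_subtrees G.
       A (abs_tree (induced G W (root G))) *
       (\<Prod>C \<in> components_in (edges G) (verts G - W). B (abs_tree (induced G C (closest G C)))))"

definition graft_bullet :: "'a::comm_ring_1 tree_series \<Rightarrow> 'a tree_series" where
  "graft_bullet A = (\<lambda>T. if \<exists>T1. T = Bplus1 T1 then A (THE T1. T = Bplus1 T1) else 0)"


section \<open>The series over \<open>\<rat>(q)[x]\<close> and \<open>\<rat>(q)\<close>\<close>

type_synonym Qq = "rat poly fract"

definition q :: Qq where
  "q = to_fract [:0, 1:]"

text \<open>In the ring \<open>\<rat>(q)[x]\<close> the indeterminate \<open>x\<close> is \<open>[:0, 1:]\<close>.\<close>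

definition is_S :: "Qq poly tree_series \<Rightarrow> bool" where
  "is_S S \<longleftrightarrow> (\<forall>T.
     smul [:q:] (Susp [:q:] S) T - Crls S (smul (-1) bullet) T =
     smul ([:q:] * (1 + ([:q:] - 1) * [:0, 1:])) (Crls bullet (smul [:q:] (Susp [:q:] S))) T
       - bullet T)"

definition S_series :: "Qq poly tree_series" where
  "S_series = (THE S. is_S S)"

definition is_Omega :: "Qq tree_series \<Rightarrow> bool" where
  "is_Omega \<Omega> \<longleftrightarrow> (\<forall>T.
     Crls (smul q (Susp q \<Omega>)) bullet T - \<Omega> T = graft_bullet \<Omega> T + smul (q - 1) bullet T)"

definition Omega_q :: "Qq tree_series" where
  "Omega_q = (THE \<Omega>. is_Omega \<Omega>)"

text \<open>The substitution \<open>q \<mapsto> 1/q\<close> in \<open>\<rat>(q)\<close>: evaluate numerator and denominator at \<open>1/q\<close>. The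
  denominator does not become zero, because \<open>1/q\<close> is transcendental over \<open>\<rat>\<close>.\<close>

definition eval_inv_q :: "rat poly \<Rightarrow> Qq" where
  "eval_inv_q p = poly (map_poly (\<lambda>c. to_fract [:c:]) p) (1 / q)"

definition subst_inv_q :: "Qq \<Rightarrow> Qq" where
  "subst_inv_q f = (let (a, b) = quot_of_fract f in eval_inv_q a / eval_inv_q b)"

definition Omega_inv_q :: "Qq tree_series" where
  "Omega_inv_q = (\<lambda>T. subst_inv_q (Omega_q T))"

definition Omega_bar :: "Qq tree_series" where
  "Omega_bar = Susp (- 1 / q) Omega_inv_q"

text \<open>The coefficientwise limit of \<open>A / (1 + q x)\<close> at \<open>x = -1/q\<close>, for a series \<open>A\<close> whose
  coefficients are divisible by \<open>1 + q x\<close>.\<close>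

definition limit_series :: "Qq poly tree_series \<Rightarrow> Qq tree_series" where
  "limit_series A = (\<lambda>T. poly (A T div [:1, q:]) (- 1 / q))"

end

theory Submission
  imports Defs
begin

text \<open>At \<open>x = -1/q\<close> the factor \<open>q (1 + (q - 1) x) = 1 + (q - 1) (1 + q x)\<close> equals \<open>1\<close> and \<open>0\<close> solves
  the equation of \<open>S\<close>, so every coefficient is divisible by \<open>1 + q x\<close>. Dividing by \<open>1 + q x\<close> and
  evaluating linearizes the equation: \<open>Crls(\<bullet>, \<epsilon> B) = \<bullet> + \<epsilon> (\<bullet> \<leftarrow> B) + O(\<epsilon>\<^sup>2)\<close>, so the
  limit \<open>L\<close> satisfies \<open>q \<Sigma>\<^sub>q L - Crls(L, -\<bullet>) = \<bullet> \<leftarrow> q \<Sigma>\<^sub>q L + (q - 1) \<bullet>\<close>. The equation of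
  \<open>\<Omega>\<close> turns into the same one under \<open>q \<mapsto> 1/q\<close> followed by the suspension by \<open>-1/q\<close>. Since
  \<open>q\<^sup>n \<noteq> 1\<close> for \<open>n > 0\<close>, it determines its solution by recursion on the number of vertices.\<close>

section \<open>Connected sets, components and paths\<close>

lemma rtrancl_image:
  assumes "(x, y) \<in> r\<^sup>*" and "\<And>x y. (x, y) \<in> r \<Longrightarrow> (f x, f y) \<in> s"
  shows "(f x, f y) \<in> s\<^sup>*"
  using assms(1) by (induction rule: rtrancl_induct) (auto intro: assms(2) rtrancl_into_rtrancl)

lemma adj_rtrancl_sym: "(u, v) \<in> (adj E W)\<^sup>* \<Longrightarrow> (v, u) \<in> (adj E W)\<^sup>*"
proof -
  have "sym (adj E W)" by (auto simp: sym_def adj_def insert_commute)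
  then show "(u, v) \<in> (adj E W)\<^sup>* \<Longrightarrow> (v, u) \<in> (adj E W)\<^sup>*"
    by (meson sym_rtrancl symD)
qed

lemma connected_inI:
  assumes "\<And>v. v \<in> W \<Longrightarrow> (r, v) \<in> (adj E W)\<^sup>*"
  shows "connected_in E W"
  unfolding connected_in_def
proof (intro ballI)
  fix u v assume "u \<in> W" "v \<in> W"
  then show "(u, v) \<in> (adj E W)\<^sup>*"
    by (intro rtrancl_trans[OF adj_rtrancl_sym[OF assms] assms])
qed

lemma connected_in_image:
  assumes "connected_in E W"
    and "\<And>u v. u \<in> W \<Longrightarrow> v \<in> W \<Longrightarrow> {u, v} \<in> E \<Longrightarrow> {f u, f v} \<in> E'"
  shows "connected_in E' (f ` W)"
proof -
  have "(f u, f v) \<in> (adj E' (f ` W))\<^sup>*" if "(u, v) \<in> (adj E W)\<^sup>*" for u v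
    by (rule rtrancl_image[OF that]) (use assms(2) in \<open>auto simp: adj_def\<close>)
  then show ?thesis using assms(1) unfolding connected_in_def by blast
qed

section \<open>Connected components of a vertex set\<close>

lemma Union_components_in: "\<Union> (components_in E W) = W"
  by (auto simp: components_in_def)

lemma finite_components_in: "finite W \<Longrightarrow> finite (components_in E W)"
  by (auto simp: components_in_def)

lemma component_subset: "C \<in> components_in E W \<Longrightarrow> C \<subseteq> W"
  by (auto simp: components_in_def)

lemma component_nonempty: "C \<in> components_in E W \<Longrightarrow> C \<noteq> {}"
  by (auto simp: components_in_def)

lemma components_in_disjoint:
  assumes "C \<in> components_in E W" "D \<in> components_in E W" "C \<noteq> D"
  shows "C \<inter> D = {}"
proof (rule ccontr)
  assume "C \<inter> D \<noteq> {}"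
  then obtain z where z: "z \<in> C" "z \<in> D" by blast
  obtain u where u: "C = {v \<in> W. (u, v) \<in> (adj E W)\<^sup>*}"
    using assms(1) by (auto simp: components_in_def)
  obtain u' where u': "D = {v \<in> W. (u', v) \<in> (adj E W)\<^sup>*}"
    using assms(2) by (auto simp: components_in_def)
  have uz: "(u, z) \<in> (adj E W)\<^sup>*" "(u', z) \<in> (adj E W)\<^sup>*"
    using z u u' by auto
  have "(u, u') \<in> (adj E W)\<^sup>*"
    by (rule rtrancl_trans[OF uz(1) adj_rtrancl_sym[OF uz(2)]])
  then have "(u, v) \<in> (adj E W)\<^sup>* \<longleftrightarrow> (u', v) \<in> (adj E W)\<^sup>*" for v
    using rtrancl_trans[OF adj_rtrancl_sym, of u u' E W v] rtrancl_trans[of u u' "adj E W" v] by blast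
  then have "C = D" unfolding u u' by simp
  with assms(3) show False by blast
qed

text \<open>A walk in \<open>W\<close> that starts at the base point \<open>u\<close> of the
  component never leaves the component, because each of its vertices is reachable from
  \<open>u\<close>.\<close>

lemma connected_in_component:
  assumes "C \<in> components_in E W"
  shows "connected_in E C"
proof -
  obtain u where u: "u \<in> W" "C = {v \<in> W. (u, v) \<in> (adj E W)\<^sup>*}"
    using assms by (auto simp: components_in_def)
  have "(u, v) \<in> (adj E C)\<^sup>*" if "(u, v) \<in> (adj E W)\<^sup>*" for v
    using that
  proof (induction rule: rtrancl_induct)
    case (step y z)
    have "(u, z) \<in> (adj E W)\<^sup>*" using step.hyps by simp
    then have "(y, z) \<in> adj E C"
      using step.hyps unfolding u(2) by (auto simp: adj_def)
    with step.IH show ?case by simp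
  qed simp
  then show ?thesis
    using u(2) by (intro connected_inI[of _ u]) blast
qed

text \<open>Translates "exactly one root branch" into connectedness of the complement of the root,
  the property that singles out the trees \<open>Bplus1 T1\<close>.\<close>

lemma components_in_eq_singleton_iff:
  "components_in E W = {C} \<longleftrightarrow> W \<noteq> {} \<and> connected_in E W \<and> C = W"
proof
  assume *: "components_in E W = {C}"
  then have "C = W" using Union_components_in[of E W] by simp
  moreover have "C \<in> components_in E W" using * by simp
  ultimately show "W \<noteq> {} \<and> connected_in E W \<and> C = W"
    using connected_in_component[of C E W] component_nonempty[of C E W] by simp
next
  assume *: "W \<noteq> {} \<and> connected_in E W \<and> C = W"
  have "{v \<in> W. (u, v) \<in> (adj E W)\<^sup>*} = W" if "u \<in> W" for u
    using conjunct1[OF conjunct2[OF *]] that unfolding connected_in_def by blast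
  then have "components_in E W = (\<lambda>_. W) ` W"
    unfolding components_in_def Setcompr_eq_image by (intro image_cong refl)
  then show "components_in E W = {C}"
    using * by (auto simp: image_constant_conv)
qed

lemma simple_path_exists:
  assumes "(u, v) \<in> (adj E W)\<^sup>*" "u \<in> W"
  shows "\<exists>p. p \<noteq> [] \<and> distinct p \<and> set p \<subseteq> W \<and> hd p = u \<and> last p = v \<and>
    successively (\<lambda>a b. {a, b} \<in> E) p"
  using assms(1)
proof (induction rule: rtrancl_induct)
  case base
  show ?case using assms(2) by (intro exI[of _ "[u]"]) simp
next
  case (step y z)
  then obtain p where p: "p \<noteq> []" "distinct p" "set p \<subseteq> W" "hd p = u" "last p = y"
    "successively (\<lambda>a b. {a, b} \<in> E) p" by blast
  show ?case
  proof (cases "z \<in> set p")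
    case True
    \<comment> \<open>If the walk returns to a vertex of the path, the path is cut at that vertex
      and stays simple.\<close>
    then obtain xs ys where "p = xs @ z # ys" by (meson split_list)
    then show ?thesis
      using p by (intro exI[of _ "xs @ [z]"]) (auto simp: successively_append_iff hd_append)
  next
    case False
    then show ?thesis
      using p step.hyps(2)
      by (intro exI[of _ "p @ [z]"]) (auto simp: successively_append_iff adj_def)
  qed
qed

text \<open>Two different edges from \<open>r\<close> into a connected set avoiding \<open>r\<close> would close a cycle.\<close>

lemma acyclic_unique_attachment:
  assumes acyc: "\<nexists>vs. is_cycle E vs"
    and "r \<notin> C" "connected_in E C" "u \<in> C" "v \<in> C" "{r, u} \<in> E" "{r, v} \<in> E"
  shows "u = v"
proof (rule ccontr)
  assume "u \<noteq> v"
  have "(u, v) \<in> (adj E C)\<^sup>*" using assms by (simp add: connected_in_def)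
  then obtain p where p: "p \<noteq> []" "distinct p" "set p \<subseteq> C" "hd p = u" "last p = v"
    "successively (\<lambda>a b. {a, b} \<in> E) p"
    using simple_path_exists[OF _ assms(4)] by blast
  have len: "2 \<le> length p"
    using p \<open>u \<noteq> v\<close> by (cases p; cases "tl p") auto
  \<comment> \<open>The cycle is \<open>r\<close> followed by the simple path from \<open>u\<close>
    to \<open>v\<close>. The three cases are the edge from \<open>r\<close> to \<open>u\<close>, an
    edge of the path, and the closing edge from \<open>v\<close> back to \<open>r\<close>.\<close>
  have "{(r # p) ! i, (r # p) ! (Suc i mod length (r # p))} \<in> E" if "i < length (r # p)" for i
  proof -
    have "i < length p \<or> i = length p" using that by auto
    then consider "i = 0" | j where "i = Suc j" "Suc j < length p" | "i = length p"
      by (cases i) blast+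
    then show ?thesis
    proof cases
      case 1
      then show ?thesis using p(1,4) assms(6) len by (simp add: hd_conv_nth)
    next
      case 2
      then show ?thesis using p(6) by (simp add: successively_conv_nth)
    next
      case 3
      have "(r # p) ! length p = v" using p(1,5) by (cases p) (auto simp: last_conv_nth)
      then show ?thesis using 3 assms(7) by (simp add: insert_commute)
    qed
  qed
  moreover have "distinct (r # p)" using p assms(2) by auto
  moreover have "3 \<le> length (r # p)" using len by simp
  ultimately have "is_cycle E (r # p)" unfolding is_cycle_def by blast
  with acyc show False by blast
qed


section \<open>Rooted trees and their isomorphism classes\<close>

lemma is_rtree_rep_tree: "is_rtree (rep_tree T)"
  using Quotient3_rep_reflp[OF Quotient3_tree] by (auto simp: rtree_equiv_def)

lemma abs_rep_tree: "abs_tree (rep_tree T) = T"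
  by (rule Quotient3_abs_rep[OF Quotient3_tree])

lemma abs_tree_eqI:
  "is_rtree G \<Longrightarrow> is_rtree H \<Longrightarrow> rgraph_iso f G H \<Longrightarrow> abs_tree G = abs_tree H"
  by (rule Quotient3_rel_abs[OF Quotient3_tree]) (auto simp: rtree_equiv_def)

lemma rtree_equiv_refl: "is_rtree G \<Longrightarrow> rtree_equiv G G"
  by (auto simp: rtree_equiv_def rgraph_iso_def intro!: exI[of _ id])

text \<open>\<open>rep_tree\<close> picks an arbitrary representative, so whatever is computed on it
  has to be carried to a given graph along an isomorphism.\<close>

lemma rep_abs_tree_iso:
  assumes "is_rtree G"
  obtains f where "rgraph_iso f (rep_tree (abs_tree G)) G"
  using Quotient3_rep_abs[OF Quotient3_tree rtree_equiv_refl[OF assms]]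
  by (auto simp: rtree_equiv_def)

lemma finite_verts: "is_rtree G \<Longrightarrow> finite (verts G)"
  by (simp add: is_rtree_def)

lemma root_in_verts: "is_rtree G \<Longrightarrow> root G \<in> verts G"
  by (simp add: is_rtree_def)

lemma edge_distinct: "is_rtree G \<Longrightarrow> {u, v} \<in> edges G \<Longrightarrow> u \<noteq> v"
  unfolding is_rtree_def by (metis doubleton_eq_iff)

lemma edge_subset_verts: "is_rtree G \<Longrightarrow> e \<in> edges G \<Longrightarrow> e \<subseteq> verts G"
  unfolding is_rtree_def by fastforce

lemma tree_size_abs_tree: "is_rtree G \<Longrightarrow> tree_size (abs_tree G) = card (verts G)"
  by (erule rep_abs_tree_iso) (auto simp: tree_size_def rgraph_iso_def bij_betw_same_card)

lemma tree_size_pos: "0 < tree_size T"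
  unfolding tree_size_def
  using is_rtree_rep_tree[of T] finite_verts root_in_verts by (auto simp: card_gt_0_iff)

lemma is_rtree_single: "is_rtree (RGraph {0} {} 0)"
  by (auto simp: is_rtree_def connected_in_def is_cycle_def intro!: exI[of _ 0])

lemma tree_size_eq_1_iff: "tree_size T = 1 \<longleftrightarrow> T = one_tree"
proof
  assume *: "tree_size T = 1"
  let ?G = "rep_tree T"
  have G: "is_rtree ?G" by (rule is_rtree_rep_tree)
  have "verts ?G = {root ?G}"
    using * root_in_verts[OF G] by (auto simp: tree_size_def card_1_singleton_iff)
  \<comment> \<open>\<open>rgraph_iso\<close> compares edges also for \<open>u = v\<close>, so the
    loop at the root must be ruled out.\<close>
  moreover have "{root ?G} \<notin> edges ?G"
    using edge_distinct[OF G, of "root ?G" "root ?G"] by auto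
  ultimately have "rgraph_iso (\<lambda>_. 0) ?G (RGraph {0} {} 0)"
    by (auto simp: rgraph_iso_def bij_betw_def)
  then show "T = one_tree"
    using abs_tree_eqI[OF G is_rtree_single] abs_rep_tree by (simp add: one_tree_def)
next
  assume "T = one_tree"
  then show "tree_size T = 1"
    by (simp add: one_tree_def tree_size_abs_tree[OF is_rtree_single])
qed

lemma bullet_eq: "bullet T = (if tree_size T = 1 then 1 else 0)"
  by (simp add: bullet_def tree_size_eq_1_iff del: One_nat_def)

section \<open>Induced subgraphs and the vertex closest to the root\<close>

lemma induced_simps [simp]:
  "verts (induced G W r) = W" "root (induced G W r) = r"
  "edges (induced G W r) = {e \<in> edges G. e \<subseteq> W}"
  by (simp_all add: induced_def)

lemma is_rtree_induced:
  assumes "is_rtree G" "W \<subseteq> verts G" "r \<in> W" "connected_in (edges G) W"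
  shows "is_rtree (induced G W r)"
proof -
  have "adj {e \<in> edges G. e \<subseteq> W} W = adj (edges G) W"
    by (auto simp: adj_def)
  then have "connected_in {e \<in> edges G. e \<subseteq> W} W"
    using assms(4) by (simp add: connected_in_def)
  moreover have "\<nexists>vs. is_cycle {e \<in> edges G. e \<subseteq> W} vs"
    using assms(1) by (auto simp: is_rtree_def is_cycle_def)
  moreover have "\<exists>u v. u \<in> W \<and> v \<in> W \<and> u \<noteq> v \<and> e = {u, v}" if "e \<in> edges G" "e \<subseteq> W" for e
    using assms(1) that unfolding is_rtree_def by (metis insert_subset)
  ultimately show ?thesis
    using assms finite_subset by (auto simp: is_rtree_def)
qed

lemma closest_in: "finite C \<Longrightarrow> C \<noteq> {} \<Longrightarrow> closest G C \<in> C"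
  by (simp add: closest_def arg_min_if_finite(1))

text \<open>The first step of a walk from the root to any other vertex reaches a neighbour
  \<open>w\<close> of the root, at distance at most 1. The minimizer is therefore at distance at
  most 1 too, and not at distance 0, since it is not the root.\<close>

lemma closest_adjacent_root:
  assumes G: "is_rtree G" and C: "C = verts G - {root G}" "C \<noteq> {}"
  shows "{root G, closest G C} \<in> edges G"
proof -
  let ?A = "adj (edges G) (verts G)" and ?c = "closest G C"
  have fin: "finite C" using finite_verts[OF G] C(1) by simp
  have conn: "(root G, v) \<in> ?A\<^sup>*" if "v \<in> verts G" for v
    using G that by (auto simp: is_rtree_def connected_in_def)
  obtain v where v: "v \<in> C" using C(2) by blast
  have "root G \<noteq> v" and "(root G, v) \<in> ?A\<^sup>*" using conn[of v] v C(1) by auto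
  then obtain w where w: "(root G, w) \<in> ?A"
    by (auto elim: converse_rtranclE)
  then have "w \<in> C"
    using C(1) edge_distinct[OF G, of "root G" w] by (auto simp: adj_def)
  have "root_dist G w \<le> 1"
    unfolding root_dist_def by (rule Least_le) (use w in simp)
  then have le: "root_dist G ?c \<le> 1"
    using arg_min_least[OF fin C(2) \<open>w \<in> C\<close>, of "root_dist G"] by (simp add: closest_def)
  have c: "?c \<in> C" using closest_in[OF fin C(2)] .
  \<comment> \<open>The \<open>LEAST\<close> in \<open>root_dist\<close> is attained only once some
    walk to the vertex is known.\<close>
  have "\<exists>n. (root G, ?c) \<in> ?A ^^ n"
    using conn[of ?c] c C(1) rtrancl_imp_relpow by blast
  then have path: "(root G, ?c) \<in> ?A ^^ root_dist G ?c"
    unfolding root_dist_def by (rule LeastI_ex)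
  then have "root_dist G ?c \<noteq> 0"
    using c C(1) by (metis DiffE insertI1 pair_in_Id_conv relpow.simps(1))
  with le path have "(root G, ?c) \<in> ?A" by (simp add: le_Suc_eq)
  then show ?thesis by (simp add: adj_def)
qed


section \<open>Grafting on the one-vertex tree\<close>

text \<open>The concrete graph behind \<open>Bplus1\<close>, named so that it can be studied before
  passing to isomorphism classes.\<close>

definition graft_root :: "rgraph \<Rightarrow> rgraph" where
  "graft_root G = RGraph (insert 0 (Suc ` verts G))
     (insert {0, Suc (root G)} ((`) Suc ` edges G)) 0"

lemma Bplus1_eq: "Bplus1 T = abs_tree (graft_root (rep_tree T))"
  by (simp add: Bplus1_def graft_root_def Let_def)

lemma graft_root_simps [simp]:
  "verts (graft_root G) = insert 0 (Suc ` verts G)" "root (graft_root G) = 0"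
  by (simp_all add: graft_root_def)

lemma graft_root_edge_iffs:
  "{0} \<notin> edges (graft_root G)"
  "{0, Suc v} \<in> edges (graft_root G) \<longleftrightarrow> v = root G"
  "{Suc v, 0} \<in> edges (graft_root G) \<longleftrightarrow> v = root G"
  "{Suc u, Suc v} \<in> edges (graft_root G) \<longleftrightarrow> {u, v} \<in> edges G"
proof -
  have 0: "{0, x} \<noteq> Suc ` e" for x e by blast
  have "{Suc u, Suc v} = Suc ` e \<longleftrightarrow> e = {u, v}" for e
    using inj_image_eq_iff[of Suc "{u, v}" e] by auto
  moreover have "{Suc u, Suc v} \<noteq> {0, x}" for x by blast
  ultimately show "{Suc u, Suc v} \<in> edges (graft_root G) \<longleftrightarrow> {u, v} \<in> edges G"
    unfolding graft_root_def by (simp add: image_iff)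
  show "{0} \<notin> edges (graft_root G)"
    using 0[of 0] by (auto simp: graft_root_def)
  show "{0, Suc v} \<in> edges (graft_root G) \<longleftrightarrow> v = root G"
    using 0 by (auto simp: graft_root_def doubleton_eq_iff)
  then show "{Suc v, 0} \<in> edges (graft_root G) \<longleftrightarrow> v = root G"
    by (simp add: insert_commute)
qed

text \<open>The new root has a single neighbour, whereas a vertex on a cycle has two. A cycle that
  avoids the new root shifts back to a cycle of \<open>G\<close>.\<close>

lemma graft_root_acyclic:
  assumes "is_rtree G"
  shows "\<not> is_cycle (edges (graft_root G)) vs"
proof
  assume cyc: "is_cycle (edges (graft_root G)) vs"
  let ?n = "length vs"
  have n: "3 \<le> ?n" and d: "distinct vs" using cyc by (auto simp: is_cycle_def)
  have e: "{vs ! i, vs ! (Suc i mod ?n)} \<in> edges (graft_root G)" if "i < ?n" for i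
    using cyc that by (simp add: is_cycle_def)
  show False
  proof (cases "0 \<in> set vs")
    case True
    then obtain i where i: "i < ?n" "vs ! i = 0" by (auto simp: in_set_conv_nth)
    \<comment> \<open>\<open>j\<close> and \<open>k\<close> are the positions before and after
      \<open>i\<close> on the cycle; they differ because the cycle has at least three
      vertices.\<close>
    define j where "j = (if i = 0 then ?n - 1 else i - 1)"
    define k where "k = Suc i mod ?n"
    have j: "j < ?n" "Suc j mod ?n = i" using i(1) n by (auto simp: j_def)
    have k: "k < ?n" unfolding k_def using n by (intro mod_less_divisor) linarith
    have "j \<noteq> k"
      using i(1) n by (cases "Suc i = ?n") (auto simp: j_def k_def)
    have nb: "x = Suc (root G)" if "{0, x} \<in> edges (graft_root G)" for x
      using that by (cases x) (auto simp: graft_root_edge_iffs)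
    have "vs ! k = Suc (root G)" using nb e[OF i(1)] i(2) k_def by simp
    moreover have "vs ! j = Suc (root G)"
      using nb e[OF j(1)] i(2) j(2) by (simp add: insert_commute)
    ultimately show False
      using \<open>j \<noteq> k\<close> nth_eq_iff_index_eq[OF d j(1) k] by simp
  next
    case False
    have pos: "vs ! i \<noteq> 0" if "i < ?n" for i
      using False that by (metis nth_mem)
    have "is_cycle (edges G) (map (\<lambda>x. x - 1) vs)"
      unfolding is_cycle_def
    proof (intro conjI allI impI)
      show "3 \<le> length (map (\<lambda>x. x - 1) vs)" using n by simp
      show "distinct (map (\<lambda>x. x - 1) vs)"
        unfolding distinct_map
      proof (intro conjI d inj_onI)
        fix x y assume "x \<in> set vs" "y \<in> set vs" "x - 1 = y - 1"
        moreover from this have "x \<noteq> 0" "y \<noteq> 0" using False by metis+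
        ultimately show "x = y" by simp
      qed
      fix i assume "i < length (map (\<lambda>x. x - 1) vs)"
      then have i: "i < ?n" by simp
      have k: "Suc i mod ?n < ?n" using n by (intro mod_less_divisor) linarith
      obtain a b where ab: "vs ! i = Suc a" "vs ! (Suc i mod ?n) = Suc b"
        using pos[OF i] pos[OF k] not0_implies_Suc by metis
      then have "{a, b} \<in> edges G" using e[OF i] by (simp add: graft_root_edge_iffs)
      then show "{map (\<lambda>x. x - 1) vs ! i,
          map (\<lambda>x. x - 1) vs ! (Suc i mod length (map (\<lambda>x. x - 1) vs))} \<in> edges G"
        using i k ab by simp
    qed
    then show False using assms by (auto simp: is_rtree_def)
  qed
qed

lemma is_rtree_graft_root:
  assumes "is_rtree G"
  shows "is_rtree (graft_root G)"
proof -
  let ?G = "graft_root G"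
  let ?A = "adj (edges ?G) (verts ?G)"
  have e: "\<exists>u v. u \<in> verts ?G \<and> v \<in> verts ?G \<and> u \<noteq> v \<and> e = {u, v}"
    if e: "e \<in> edges ?G" for e
  proof (cases "e = {0, Suc (root G)}")
    case True
    then show ?thesis using root_in_verts[OF assms] by auto
  next
    case False
    then obtain e' where e': "e' \<in> edges G" "e = Suc ` e'"
      using e by (auto simp: graft_root_def)
    then obtain u v where "u \<in> verts G" "v \<in> verts G" "u \<noteq> v" "e' = {u, v}"
      using assms unfolding is_rtree_def by meson
    with e' show ?thesis by (intro exI[of _ "Suc u"] exI[of _ "Suc v"]) auto
  qed
  have "(0, v) \<in> ?A\<^sup>*" if v: "v \<in> verts ?G" for v
  proof (cases v)
    case (Suc w)
    then have "w \<in> verts G" using v by auto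
    then have "(root G, w) \<in> (adj (edges G) (verts G))\<^sup>*"
      using assms by (simp add: is_rtree_def connected_in_def)
    then have "(Suc (root G), Suc w) \<in> ?A\<^sup>*"
      by (rule rtrancl_image) (auto simp: adj_def graft_root_edge_iffs)
    moreover have "(0, Suc (root G)) \<in> ?A"
      using root_in_verts[OF assms] by (simp add: adj_def graft_root_edge_iffs)
    ultimately show ?thesis using Suc by (simp add: converse_rtrancl_into_rtrancl)
  qed simp
  then have "connected_in (edges ?G) (verts ?G)" by (rule connected_inI)
  then show ?thesis
    using e graft_root_acyclic[OF assms] finite_verts[OF assms]
    by (auto simp: is_rtree_def)
qed

text \<open>Exactly one edge joins the root to \<open>C\<close>, and it ends at
  \<open>closest G C\<close>: it exists by \<open>closest_adjacent_root\<close> and is unique by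
  \<open>acyclic_unique_attachment\<close>. Hence \<open>G\<close> is its only branch with a new
  root on top.\<close>

lemma Bplus1_of_connected_complement:
  assumes G: "is_rtree G" and C: "C = verts G - {root G}" "C \<noteq> {}" "connected_in (edges G) C"
  shows "abs_tree G = Bplus1 (abs_tree (induced G C (closest G C)))"
proof -
  let ?c = "closest G C"
  have fin: "finite C" using finite_verts[OF G] C(1) by simp
  have c: "?c \<in> C" using closest_in[OF fin C(2)] .
  have I: "is_rtree (induced G C ?c)"
    using is_rtree_induced[OF G _ c C(3)] C(1) by blast
  define H where "H = rep_tree (abs_tree (induced G C ?c))"
  obtain f where f: "rgraph_iso f H (induced G C ?c)"
    using rep_abs_tree_iso[OF I] unfolding H_def by blast
  have H: "is_rtree H" by (simp add: H_def is_rtree_rep_tree)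
  have bij: "bij_betw f (verts H) C" and fr: "f (root H) = ?c"
    using f by (auto simp: rgraph_iso_def)
  have fC: "f u \<in> C" if "u \<in> verts H" for u using bij that by (auto simp: bij_betw_def)
  have fe: "{f u, f v} \<in> edges G \<longleftrightarrow> {u, v} \<in> edges H" if "u \<in> verts H" "v \<in> verts H" for u v
    using f fC that by (auto simp: rgraph_iso_def)
  have acyc: "\<nexists>vs. is_cycle (edges G) vs" using G by (simp add: is_rtree_def)
  have rC: "root G \<notin> C" by (simp add: C(1))
  have att: "{root G, f v} \<in> edges G \<longleftrightarrow> v = root H" if "v \<in> verts H" for v
  proof
    assume "{root G, f v} \<in> edges G"
    then have "f v = ?c"
      using acyclic_unique_attachment[OF acyc rC C(3) fC[OF that] c]
        closest_adjacent_root[OF G C(1,2)] by simp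
    then show "v = root H"
      using inj_onD[OF bij_betw_imp_inj_on[OF bij], of v "root H"] that fr root_in_verts[OF H]
      by simp
  qed (use fr closest_adjacent_root[OF G C(1,2)] in simp)
  \<comment> \<open>The isomorphism \<open>f\<close> of the branches is extended by matching the new
    root \<open>0\<close> with \<open>root G\<close>.\<close>
  define g where "g = case_nat (root G) f"
  have g: "g 0 = root G" "g (Suc v) = f v" for v by (simp_all add: g_def)
  have "inj_on (g \<circ> Suc) (verts H)"
    using bij_betw_imp_inj_on[OF bij] by (simp add: comp_def g)
  then have "inj_on g (Suc ` verts H)" by (rule inj_on_imageI)
  moreover have im: "g ` Suc ` verts H = C"
    by (simp add: image_image g bij_betw_imp_surj_on[OF bij])
  ultimately have "bij_betw g (Suc ` verts H) C" by (simp add: bij_betw_def)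
  then have "bij_betw g (Suc ` verts H \<union> {0}) (C \<union> {g 0})"
    by (intro notIn_Un_bij_betw) (use rC g in auto)
  then have "bij_betw g (insert 0 (Suc ` verts H)) (verts G)"
    using root_in_verts[OF G] by (simp add: C(1) g insert_absorb)
  moreover have "{root G} \<notin> edges G"
    using edge_distinct[OF G, of "root G" "root G"] by auto
  then have "{g u, g v} \<in> edges G \<longleftrightarrow> {u, v} \<in> edges (graft_root H)"
    if "u \<in> insert 0 (Suc ` verts H)" "v \<in> insert 0 (Suc ` verts H)" for u v
    using that by (cases u; cases v)
      (simp_all add: g graft_root_edge_iffs att fe inj_image_mem_iff
        insert_commute[of "f _" "root G"])
  ultimately have "rgraph_iso g (graft_root H) G"
    by (simp add: rgraph_iso_def g)
  then have "abs_tree (graft_root H) = abs_tree G"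
    by (rule abs_tree_eqI[OF is_rtree_graft_root[OF H] G])
  then show ?thesis by (simp add: Bplus1_eq H_def)
qed

text \<open>The converse direction. Recovering \<open>T1\<close> from the graph also makes
  \<open>Bplus1\<close> injective, so that the \<open>THE\<close> in \<open>graft_bullet\<close> is
  well defined.\<close>

lemma connected_complement_of_Bplus1:
  assumes G: "is_rtree G" and T: "abs_tree G = Bplus1 T1" and C: "C = verts G - {root G}"
  shows "C \<noteq> {}" "connected_in (edges G) C" "abs_tree (induced G C (closest G C)) = T1"
proof -
  let ?c = "closest G C"
  define H where "H = rep_tree T1"
  have H: "is_rtree H" by (simp add: H_def is_rtree_rep_tree)
  have GH: "is_rtree (graft_root H)" by (rule is_rtree_graft_root[OF H])
  have "rtree_equiv (graft_root H) G"
    using T Quotient3_rel[OF Quotient3_tree, of "graft_root H" G]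
      rtree_equiv_refl[OF GH] rtree_equiv_refl[OF G]
    by (simp add: Bplus1_eq H_def)
  then obtain g where g: "rgraph_iso g (graft_root H) G" by (auto simp: rtree_equiv_def)
  let ?f = "\<lambda>v. g (Suc v)"
  have bij: "bij_betw g (insert 0 (Suc ` verts H)) (verts G)" and g0: "g 0 = root G"
    using g by (auto simp: rgraph_iso_def)
  have ge: "{g u, g v} \<in> edges G \<longleftrightarrow> {u, v} \<in> edges (graft_root H)"
    if "u \<in> insert 0 (Suc ` verts H)" "v \<in> insert 0 (Suc ` verts H)" for u v
    using g that unfolding rgraph_iso_def graft_root_simps by blast
  have inj': "inj_on g (insert 0 (Suc ` verts H))"
    by (rule bij_betw_imp_inj_on[OF bij])
  have inj: "inj_on ?f (verts H)"
    by (rule inj_onI) (use inj_onD[OF inj'] in blast)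
  have "g 0 \<notin> ?f ` verts H"
    using inj_onD[OF inj', of 0] by blast
  moreover have "verts G = insert (g 0) (?f ` verts H)"
    using bij_betw_imp_surj_on[OF bij] by (simp add: image_image)
  ultimately have im: "?f ` verts H = C" using C g0 by auto
  have fe: "{?f u, ?f v} \<in> edges G \<longleftrightarrow> {u, v} \<in> edges H"
    if "u \<in> verts H" "v \<in> verts H" for u v
    using ge[of "Suc u" "Suc v"] that by (simp add: graft_root_edge_iffs)
  show ne: "C \<noteq> {}" using im root_in_verts[OF H] by blast
  have "connected_in (edges H) (verts H)" using H by (simp add: is_rtree_def)
  then show conn: "connected_in (edges G) C"
    unfolding im[symmetric] by (rule connected_in_image) (use fe in blast)
  have c: "?c \<in> C" using closest_in[OF _ ne] finite_verts[OF G] C by simp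
  have e: "{root G, ?f (root H)} \<in> edges G"
    using ge[of 0 "Suc (root H)"] root_in_verts[OF H] g0 by (simp add: graft_root_edge_iffs)
  have acyc: "\<nexists>vs. is_cycle (edges G) vs" using G by (simp add: is_rtree_def)
  have "root G \<notin> C" and "?f (root H) \<in> C" using im root_in_verts[OF H] C by auto
  \<comment> \<open>Both vertices are joined to the root of \<open>G\<close>, and only one vertex of
    \<open>C\<close> can be.\<close>
  then have "?f (root H) = ?c"
    using acyclic_unique_attachment[OF acyc _ conn _ c e closest_adjacent_root[OF G C ne]]
    by blast
  then have "rgraph_iso ?f H (induced G C ?c)"
    using inj im fe by (auto simp: rgraph_iso_def bij_betw_def)
  moreover have "is_rtree (induced G C ?c)"
    using is_rtree_induced[OF G _ c conn] C by blast
  ultimately have "abs_tree H = abs_tree (induced G C ?c)"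
    by (intro abs_tree_eqI[OF H])
  then show "abs_tree (induced G C ?c) = T1" by (simp add: H_def abs_rep_tree)
qed


section \<open>Coefficients of the operation Crls\<close>

text \<open>This definition and the next three name the pieces of a summand of \<open>Crls\<close>:
  \<open>W\<close> is the vertex set of a subtree T_0, and the branches are the components of its
  complement.\<close>

definition trunks :: "tree \<Rightarrow> nat set set" where
  "trunks T = root_subtrees (rep_tree T)"

definition trunk :: "tree \<Rightarrow> nat set \<Rightarrow> tree" where
  "trunk T W = abs_tree (induced (rep_tree T) W (root (rep_tree T)))"

definition branches :: "tree \<Rightarrow> nat set \<Rightarrow> nat set set" where
  "branches T W = components_in (edges (rep_tree T)) (verts (rep_tree T) - W)"

definition branch :: "tree \<Rightarrow> nat set \<Rightarrow> tree" where
  "branch T C = abs_tree (induced (rep_tree T) C (closest (rep_tree T) C))"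

text \<open>Vertex sets of the trees T_1, ..., T_k in the decomposition T = B_+(T_1, ...,
  T_k).\<close>

definition root_branches :: "tree \<Rightarrow> nat set set" where
  "root_branches T = branches T {root (rep_tree T)}"

lemma Crls_eq:
  "Crls A B T = (\<Sum>W\<in>trunks T. A (trunk T W) * (\<Prod>C\<in>branches T W. B (branch T C)))"
  by (simp add: Crls_def Let_def trunks_def trunk_def branches_def branch_def)

lemma trunk_subset: "W \<in> trunks T \<Longrightarrow> W \<subseteq> verts (rep_tree T)"
  by (simp add: trunks_def root_subtrees_def)

lemma finite_verts_rep: "finite (verts (rep_tree T))"
  by (rule finite_verts[OF is_rtree_rep_tree])

lemma finite_trunks: "finite (trunks T)"
  by (rule finite_subset[of _ "Pow (verts (rep_tree T))"])
    (use trunk_subset finite_verts_rep in auto)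

lemma finite_branches: "finite (branches T W)"
  by (simp add: branches_def finite_components_in finite_verts_rep)

lemma verts_in_trunks: "verts (rep_tree T) \<in> trunks T"
  using is_rtree_rep_tree[of T] by (simp add: trunks_def root_subtrees_def is_rtree_def)

lemma root_in_trunks: "{root (rep_tree T)} \<in> trunks T"
  using root_in_verts[OF is_rtree_rep_tree]
  by (simp add: trunks_def root_subtrees_def connected_in_def)

lemma trunk_verts: "trunk T (verts (rep_tree T)) = T"
proof -
  have "induced (rep_tree T) (verts (rep_tree T)) (root (rep_tree T)) = rep_tree T"
    using edge_subset_verts[OF is_rtree_rep_tree[of T]] by (intro rgraph.expand) auto
  then show ?thesis by (simp add: trunk_def abs_rep_tree)
qed

lemma tree_size_trunk:
  assumes "W \<in> trunks T"
  shows "tree_size (trunk T W) = card W"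
  using assms tree_size_abs_tree[OF is_rtree_induced[OF is_rtree_rep_tree]]
  by (simp add: trunks_def trunk_def root_subtrees_def)

lemma tree_size_trunk_less:
  assumes "W \<in> trunks T - {verts (rep_tree T)}"
  shows "tree_size (trunk T W) < tree_size T"
proof -
  have "W \<subset> verts (rep_tree T)" using assms trunk_subset[of W T] by auto
  then have "card W < tree_size T"
    unfolding tree_size_def by (rule psubset_card_mono[OF finite_verts_rep])
  then show ?thesis using assms by (simp add: tree_size_trunk)
qed

lemma tree_size_branch:
  assumes "C \<in> branches T W"
  shows "tree_size (branch T C) = card C"
proof -
  have C: "C \<subseteq> verts (rep_tree T)" "C \<noteq> {}" "connected_in (edges (rep_tree T)) C"
    using component_subset component_nonempty connected_in_component assms
    unfolding branches_def by blast+
  have "closest (rep_tree T) C \<in> C"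
    using C finite_subset[OF _ finite_verts_rep] by (blast intro: closest_in)
  from tree_size_abs_tree[OF is_rtree_induced[OF is_rtree_rep_tree C(1) this C(3)]]
  show ?thesis by (simp add: branch_def)
qed

text \<open>The branches partition the complement of \<open>W\<close>. This count makes root
  branches smaller than the tree and yields the exponent of \<open>s\<close> in
  \<open>prune\<close>.\<close>

lemma sum_tree_size_branches:
  assumes "W \<subseteq> verts (rep_tree T)"
  shows "(\<Sum>C\<in>branches T W. tree_size (branch T C)) = tree_size T - card W"
proof -
  let ?V = "verts (rep_tree T)"
  have "pairwise disjnt (branches T W)"
    unfolding branches_def pairwise_def disjnt_def using components_in_disjoint by blast
  moreover have "finite C" if "C \<in> branches T W" for C
    using component_subset[of C] that finite_subset[of C "?V - W"] finite_verts_rep[of T]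
    unfolding branches_def by blast
  ultimately have "card (\<Union> (branches T W)) = sum card (branches T W)"
    by (rule card_Union_disjoint)
  also have "\<Union> (branches T W) = ?V - W"
    by (simp add: branches_def Union_components_in)
  also have "card (?V - W) = tree_size T - card W"
    unfolding tree_size_def
    by (rule card_Diff_subset) (use assms finite_subset finite_verts_rep in auto)
  finally show ?thesis by (simp add: tree_size_branch)
qed

lemma sum_tree_size_root_branches:
  "(\<Sum>C\<in>root_branches T. tree_size (branch T C)) = tree_size T - 1"
  using sum_tree_size_branches[OF trunk_subset[OF root_in_trunks]]
  by (simp add: root_branches_def)

lemma finite_root_branches: "finite (root_branches T)"
  by (simp add: root_branches_def finite_branches)

lemma tree_size_root_branch_less:
  assumes "C \<in> root_branches T"
  shows "tree_size (branch T C) < tree_size T"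
proof -
  have "tree_size (branch T C) \<le> (\<Sum>C\<in>root_branches T. tree_size (branch T C))"
    by (rule member_le_sum[OF assms]) (simp_all add: finite_root_branches)
  then show ?thesis
    using sum_tree_size_root_branches[of T] tree_size_pos[of T] by linarith
qed

lemma root_branches_empty_iff: "root_branches T = {} \<longleftrightarrow> tree_size T = 1"
proof
  assume "root_branches T = {}"
  then have "tree_size T - 1 = 0" using sum_tree_size_root_branches[of T] by simp
  then show "tree_size T = 1" using tree_size_pos[of T] by linarith
next
  assume "tree_size T = 1"
  then have "\<forall>C\<in>root_branches T. tree_size (branch T C) = 0"
    using sum_tree_size_root_branches[of T] finite_root_branches by simp
  then show "root_branches T = {}"
    using tree_size_pos by (metis equals0I less_irrefl)
qed

text \<open>Makes \<open>bullet\<close>, \<open>graft_bullet\<close> and the products over root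
  branches comparable by one case distinction on the number of root branches.\<close>

lemma bullet_eq_card: "bullet T = (if card (root_branches T) = 0 then 1 else 0)"
  by (simp only: bullet_eq root_branches_empty_iff[symmetric] card_0_eq[OF finite_root_branches])

text \<open>The part of \<open>Crls A (s \<bullet>)\<close> in which at least one vertex is cut off: such vertices are leaves.\<close>

definition prune :: "'a::comm_ring_1 \<Rightarrow> 'a tree_series \<Rightarrow> 'a tree_series" where
  "prune s A T = (\<Sum>W\<in>trunks T - {verts (rep_tree T)}.
     of_bool (\<forall>C\<in>branches T W. tree_size (branch T C) = 1) *
       s ^ (tree_size T - tree_size (trunk T W)) * A (trunk T W))"

text \<open>If every branch is a single vertex, there are as many branches as vertices outside
  \<open>W\<close>, each giving a factor \<open>s\<close>; otherwise some factor vanishes.\<close>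

lemma prod_branches_smul_bullet:
  assumes "W \<in> trunks T"
  shows "(\<Prod>C\<in>branches T W. smul s bullet (branch T C)) =
    of_bool (\<forall>C\<in>branches T W. tree_size (branch T C) = 1) *
      s ^ (tree_size T - tree_size (trunk T W))"
proof (cases "\<forall>C\<in>branches T W. tree_size (branch T C) = 1")
  case True
  then have "card (branches T W) = tree_size T - card W"
    using sum_tree_size_branches[OF trunk_subset[OF assms]] by simp
  then show ?thesis
    using True assms by (simp add: smul_def bullet_eq tree_size_trunk)
next
  case False
  then obtain C where "C \<in> branches T W" "tree_size (branch T C) \<noteq> 1" by blast
  then have "(\<Prod>C\<in>branches T W. smul s bullet (branch T C)) = 0"
    by (intro prod_zero[OF finite_branches]) (auto simp: smul_def bullet_eq)
  with False show ?thesis by auto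
qed

text \<open>The full vertex set contributes \<open>A T\<close>, and all other trunks are smaller
  than \<open>T\<close>. Separating the two is what permits recursion on the number of
  vertices.\<close>

lemma Crls_smul_bullet: "Crls A (smul s bullet) T = A T + prune s A T"
proof -
  let ?F = "\<lambda>W. of_bool (\<forall>C\<in>branches T W. tree_size (branch T C) = 1) *
    s ^ (tree_size T - tree_size (trunk T W)) * A (trunk T W)"
  have "Crls A (smul s bullet) T = sum ?F (trunks T)"
    unfolding Crls_eq
    by (intro sum.cong refl) (simp add: prod_branches_smul_bullet algebra_simps)
  also have "\<dots> = ?F (verts (rep_tree T)) + prune s A T"
    unfolding prune_def by (rule sum.remove[OF finite_trunks verts_in_trunks])
  also have "branches T (verts (rep_tree T)) = {}"
    by (simp add: branches_def components_in_def)
  finally show ?thesis by (simp add: trunk_verts)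
qed

text \<open>\<open>bullet\<close> vanishes on trunks with more than one vertex, so only the trunk
  consisting of the root survives.\<close>

lemma Crls_bullet: "Crls bullet B T = (\<Prod>C\<in>root_branches T. B (branch T C))"
proof -
  let ?r = "root (rep_tree T)"
  let ?F = "\<lambda>W. bullet (trunk T W) * (\<Prod>C\<in>branches T W. B (branch T C))"
  have "?F W = 0" if W: "W \<in> trunks T - {{?r}}" for W
  proof -
    have "?r \<in> W" using W by (simp add: trunks_def root_subtrees_def)
    then have "card W \<noteq> 1" using W by (auto simp: card_1_singleton_iff)
    then show ?thesis using W by (simp add: bullet_eq tree_size_trunk)
  qed
  then have "Crls bullet B T = ?F {?r}"
    unfolding Crls_eq using sum.remove[OF finite_trunks root_in_trunks, of ?F T] by simp
  then show ?thesis
    using tree_size_trunk[OF root_in_trunks[of T]] by (simp add: bullet_eq root_branches_def)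
qed

text \<open>Replaces the existential and \<open>THE\<close> of the definition by a count. The
  product has a single factor there and serves to address the only root branch.\<close>

lemma graft_bullet_eq:
  "graft_bullet A T =
    (if card (root_branches T) = 1 then \<Prod>C\<in>root_branches T. A (branch T C) else 0)"
proof -
  let ?G = "rep_tree T"
  define C where "C = verts ?G - {root ?G}"
  note complement = connected_complement_of_Bplus1[OF is_rtree_rep_tree _ C_def,
      unfolded abs_rep_tree]
  show ?thesis
  proof (cases "card (root_branches T) = 1")
    case True
    then obtain D where "root_branches T = {D}" by (auto simp: card_1_singleton_iff)
    then have eq: "root_branches T = {C}" "C \<noteq> {}" "connected_in (edges ?G) C"
      unfolding root_branches_def branches_def C_def
      by (simp_all add: components_in_eq_singleton_iff)
    have T: "T = Bplus1 (branch T C)"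
      using Bplus1_of_connected_complement[OF is_rtree_rep_tree C_def eq(2,3)]
      by (simp add: branch_def abs_rep_tree)
    have "T1 = branch T C" if "T = Bplus1 T1" for T1
      using complement(3)[OF that] by (simp add: branch_def)
    then have "(THE T1. T = Bplus1 T1) = branch T C"
      using T by (intro the_equality)
    then show ?thesis using T True eq(1) by (auto simp: graft_bullet_def)
  next
    case False
    have "T \<noteq> Bplus1 T1" for T1
    proof
      assume T: "T = Bplus1 T1"
      have "root_branches T = {C}"
        using complement(1,2)[OF T] unfolding root_branches_def branches_def C_def
        by (simp add: components_in_eq_singleton_iff)
      with False show False by simp
    qed
    with False show ?thesis by (simp add: graft_bullet_def)
  qed
qed


section \<open>Recursive determination of tree series\<close>

text \<open>Well-founded recursion on the number of vertices: the hypothesis says that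
  \<open>\<Phi> X T\<close> reads \<open>X\<close> only at trees smaller than
  \<open>T\<close>.\<close>

lemma ex1_recursive_series:
  fixes \<Phi> :: "'a tree_series \<Rightarrow> 'a tree_series"
  assumes "\<And>X Y T. (\<And>T'. tree_size T' < tree_size T \<Longrightarrow> X T' = Y T') \<Longrightarrow> \<Phi> X T = \<Phi> Y T"
  shows "\<exists>!X. \<forall>T. X T = \<Phi> X T"
proof (rule ex_ex1I)
  have "adm_wf (measure tree_size) \<Phi>"
    unfolding adm_wf_def by (auto intro: assms)
  then have "wfrec (measure tree_size) \<Phi> = \<Phi> (wfrec (measure tree_size) \<Phi>)"
    by (rule wfrec_fixpoint[OF wf_measure])
  then show "\<exists>X. \<forall>T. X T = \<Phi> X T" by metis
next
  fix X Y assume *: "\<forall>T. X T = \<Phi> X T" "\<forall>T. Y T = \<Phi> Y T"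
  have "X T = Y T" for T
  proof (induction T rule: measure_induct_rule[of tree_size])
    case (less T)
    then show ?case using assms[of T X Y] * by metis
  qed
  then show "X = Y" by blast
qed

text \<open>The inverse \<open>v\<close> is given explicitly instead of dividing by
  \<open>u\<close>, so that the lemma applies to the ring \<open>Qq poly\<close> as well as to the
  field \<open>Qq\<close>.\<close>

lemma ex1_recursive_series_unit:
  fixes u v :: "nat \<Rightarrow> 'a::comm_ring_1"
  assumes "\<And>n. 0 < n \<Longrightarrow> v n * u n = 1"
    and "\<And>X Y T. (\<And>T'. tree_size T' < tree_size T \<Longrightarrow> X T' = Y T') \<Longrightarrow> \<Phi> X T = \<Phi> Y T"
  shows "\<exists>!X. \<forall>T. u (tree_size T) * X T = \<Phi> X T"
proof -
  have "u (tree_size T) * x = y \<longleftrightarrow> x = v (tree_size T) * y" for T x y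
  proof -
    have "v (tree_size T) * (u (tree_size T) * z) = z" for z
      using assms(1)[OF tree_size_pos[of T]] by (simp add: mult.assoc[symmetric])
    then show ?thesis by (auto simp: mult.left_commute[of "u _"])
  qed
  moreover have "\<exists>!X. \<forall>T. X T = v (tree_size T) * \<Phi> X T"
  proof (rule ex1_recursive_series)
    show "v (tree_size T) * \<Phi> X T = v (tree_size T) * \<Phi> Y T"
      if "\<And>T'. tree_size T' < tree_size T \<Longrightarrow> X T' = Y T'" for X Y T
      using assms(2)[OF that] by simp
  qed
  ultimately show ?thesis by simp
qed

lemma prune_cong:
  "(\<And>T'. tree_size T' < tree_size T \<Longrightarrow> X T' = Y T') \<Longrightarrow> prune s X T = prune s Y T"
  unfolding prune_def by (intro sum.cong refl) (simp add: tree_size_trunk_less)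

lemma prod_root_branches_cong:
  "(\<And>T'. tree_size T' < tree_size T \<Longrightarrow> X T' = Y T') \<Longrightarrow>
    (\<Prod>C\<in>root_branches T. X (branch T C)) = (\<Prod>C\<in>root_branches T. Y (branch T C))"
  by (intro prod.cong refl) (simp add: tree_size_root_branch_less)

lemma graft_bullet_cong:
  "(\<And>T'. tree_size T' < tree_size T \<Longrightarrow> X T' = Y T') \<Longrightarrow> graft_bullet X T = graft_bullet Y T"
  using prod_root_branches_cong[of T X Y] by (simp add: graft_bullet_eq)

lemma smul_Susp: "smul c (Susp c A) = (\<lambda>T. c ^ tree_size T * A T)"
proof
  fix T
  have "c * c ^ (tree_size T - 1) = c ^ tree_size T"
    using tree_size_pos[of T] by (metis Suc_pred' power_Suc)
  then show "smul c (Susp c A) T = c ^ tree_size T * A T"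
    by (simp add: smul_def Susp_def mult.assoc[symmetric])
qed

lemma q_nonzero: "q \<noteq> 0"
  by (simp add: q_def)

text \<open>\<open>q ^ n - 1\<close> is the factor of the unknown coefficient at a tree with
  \<open>n\<close> vertices in each equation below, so each of them can be solved
  recursively.\<close>

lemma q_power_neq_1:
  assumes "0 < n"
  shows "q ^ n \<noteq> 1"
proof
  have "to_fract (p ^ n) = to_fract p ^ n" for p :: "rat poly"
    by (induction n) simp_all
  moreover assume "q ^ n = 1"
  ultimately have "to_fract ([:0, 1:] ^ n :: rat poly) = to_fract 1" by (simp add: q_def)
  then have "[:0, 1:] ^ n = (1 :: rat poly)" by (simp only: to_fract_eq_iff)
  then have "degree ([:0, 1:] ^ n :: rat poly) = 0" by simp
  with assms show False by (simp add: degree_power_eq)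
qed


section \<open>The series S near x = -1/q\<close>

text \<open>The coefficient \<open>S T\<close> occurs in the suspended term with factor
  \<open>[:q:] ^ tree_size T\<close> and once more through the full trunk of \<open>Crls\<close>.
  All other terms involve only smaller trees.\<close>

lemma is_S_iff:
  "is_S S \<longleftrightarrow> (\<forall>T. ([:q:] ^ tree_size T - 1) * S T = prune (-1) S T
    + (1 + [:q - 1:] * [:1, q:]) *
        (\<Prod>C\<in>root_branches T. [:q:] ^ tree_size (branch T C) * S (branch T C))
    - bullet T)"
proof -
  \<comment> \<open>Expanding around \<open>1 + q x\<close> exhibits the value 1 of this factor at
    \<open>x = -1/q\<close>.\<close>
  have factor: "[:q:] * (1 + ([:q:] - 1) * [:0, 1:]) = 1 + [:q - 1:] * [:1, q:]"
    by (simp add: one_pCons algebra_simps)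
  have rearrange: "a * s - (s + p) = c - b \<longleftrightarrow> (a - 1) * s = p + c - b" for a b c p s :: "Qq poly"
    by (auto simp: algebra_simps)
  show ?thesis
    unfolding is_S_def smul_Susp Crls_smul_bullet Crls_bullet factor rearrange
    by (simp only: smul_def Crls_bullet)
qed

lemma const_q_power_unit:
  assumes "0 < n"
  shows "[:1 / (q ^ n - 1):] * ([:q:] ^ n - 1) = 1"
proof -
  have "[:q:] ^ n - 1 = [:q ^ n - 1:]" by (simp add: poly_const_pow one_pCons)
  then show ?thesis using q_power_neq_1[OF assms] by simp
qed

lemma is_S_S_series: "is_S S_series"
proof -
  have "\<exists>!S. is_S S"
    unfolding is_S_iff
  proof (rule ex1_recursive_series_unit[where v = "\<lambda>n. [:1 / (q ^ n - 1):]"])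
    fix n :: nat assume "0 < n"
    then show "[:1 / (q ^ n - 1):] * ([:q:] ^ n - 1) = 1"
      by (rule const_q_power_unit)
  next
    fix X Y :: "Qq poly tree_series" and T
    assume *: "\<And>T'. tree_size T' < tree_size T \<Longrightarrow> X T' = Y T'"
    have "prune (-1) X T = prune (-1) Y T" by (rule prune_cong[OF *])
    moreover have
      "(\<Prod>C\<in>root_branches T. [:q:] ^ tree_size (branch T C) * X (branch T C)) =
       (\<Prod>C\<in>root_branches T. [:q:] ^ tree_size (branch T C) * Y (branch T C))"
      by (rule prod_root_branches_cong[where X = "\<lambda>T. [:q:] ^ tree_size T * X T"
            and Y = "\<lambda>T. [:q:] ^ tree_size T * Y T"]) (simp add: *)
    ultimately show
      "prune (-1) X T + (1 + [:q - 1:] * [:1, q:]) *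
         (\<Prod>C\<in>root_branches T. [:q:] ^ tree_size (branch T C) * X (branch T C)) - bullet T =
       prune (-1) Y T + (1 + [:q - 1:] * [:1, q:]) *
         (\<Prod>C\<in>root_branches T. [:q:] ^ tree_size (branch T C) * Y (branch T C)) - bullet T"
      by simp
  qed
  then show ?thesis unfolding S_series_def by (rule theI')
qed

text \<open>Modulo \<open>1 + q x\<close>, induction removes the pruned terms and leaves
  \<open>?P - bullet T\<close>. With a root branch, \<open>bullet T\<close> is 0 and
  \<open>?P\<close> has a divisible factor; without one, both equal 1.\<close>

lemma S_series_dvd: "[:1, q:] dvd S_series T"
proof (induction T rule: measure_induct_rule[of tree_size])
  case (less T)
  let ?P = "\<Prod>C\<in>root_branches T. [:q:] ^ tree_size (branch T C) * S_series (branch T C)"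
  have "p + (1 + k * w) * P - b = p + w * (k * P) + (P - b)" for p k w P b :: "Qq poly"
    by (simp add: algebra_simps)
  then have eq: "([:q:] ^ tree_size T - 1) * S_series T =
      prune (-1) S_series T + [:1, q:] * ([:q - 1:] * ?P) + (?P - bullet T)"
    using is_S_S_series unfolding is_S_iff by metis
  have "[:1, q:] dvd prune (-1) S_series T"
    unfolding prune_def by (intro dvd_sum dvd_mult less.IH tree_size_trunk_less)
  moreover have "[:1, q:] dvd ?P - bullet T"
  proof (cases "root_branches T = {}")
    case False
    then obtain C where C: "C \<in> root_branches T" by blast
    have "[:1, q:] dvd [:q:] ^ tree_size (branch T C) * S_series (branch T C)"
      by (intro dvd_mult less.IH tree_size_root_branch_less C)
    also have "\<dots> dvd ?P" by (rule dvd_prodI[OF finite_root_branches C])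
    finally show ?thesis using False by (simp add: bullet_eq_card finite_root_branches)
  qed (simp add: bullet_eq_card)
  ultimately have "[:1, q:] dvd ([:q:] ^ tree_size T - 1) * S_series T"
    unfolding eq by (intro dvd_add dvd_triv_left)
  \<comment> \<open>The factor \<open>[:q:] ^ tree_size T - 1\<close> is a unit, so divisibility
    passes to \<open>S_series T\<close> itself.\<close>
  then have "[:1, q:] dvd [:1 / (q ^ tree_size T - 1):] * (([:q:] ^ tree_size T - 1) * S_series T)"
    by (rule dvd_mult)
  also have "\<dots> = ([:1 / (q ^ tree_size T - 1):] * ([:q:] ^ tree_size T - 1)) * S_series T"
    by (simp only: mult.assoc)
  also have "[:1 / (q ^ tree_size T - 1):] * ([:q:] ^ tree_size T - 1) = 1"
    by (rule const_q_power_unit[OF tree_size_pos])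
  finally show ?case by simp
qed

text \<open>The equation for the limit \<open>L\<close>, at a single tree and with the full-trunk
  term moved to the left.\<close>

definition linearized_at :: "Qq tree_series \<Rightarrow> tree \<Rightarrow> bool" where
  "linearized_at L T \<longleftrightarrow> (q ^ tree_size T - 1) * L T =
     prune (-1) L T + graft_bullet (\<lambda>T. q ^ tree_size T * L T) T + (q - 1) * bullet T"

text \<open>The right-hand side reads \<open>L\<close> only at smaller trees, and the factor on the
  left is nonzero.\<close>

lemma linearized_unique:
  assumes "\<And>T. linearized_at L T" "\<And>T. linearized_at L' T"
  shows "L = L'"
proof
  show "L T = L' T" for T
  proof (induction T rule: measure_induct_rule[of tree_size])
    case (less T)
    have "prune (-1) L T = prune (-1) L' T" by (rule prune_cong[OF less.IH])
    moreover have "graft_bullet (\<lambda>T. q ^ tree_size T * L T) T =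
        graft_bullet (\<lambda>T. q ^ tree_size T * L' T) T"
      by (rule graft_bullet_cong) (simp add: less.IH)
    ultimately have "(q ^ tree_size T - 1) * L T = (q ^ tree_size T - 1) * L' T"
      using assms[of T] by (simp add: linearized_at_def)
    then show ?case using q_power_neq_1[OF tree_size_pos[of T]] by simp
  qed
qed

text \<open>The product over root branches contributes one factor \<open>1 + q x\<close> per branch, so to first order
  only trees with at most one root branch see it.\<close>

lemma limit_S_series_linearized: "linearized_at (limit_series S_series) T"
proof -
  define U where "U = (\<lambda>T. S_series T div [:1, q:])"
  define e where "e = - 1 / q"
  define w :: "Qq poly" where "w = [:1, q:]"
  define P where "P = (\<Prod>C\<in>root_branches T. [:q:] ^ tree_size (branch T C) * U (branch T C))"
  define k where "k = card (root_branches T)"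
  \<comment> \<open>The quotient by \<open>w\<close> of the product term minus
    \<open>bullet T\<close>. For \<open>k = 0\<close> the product is 1 and cancels against
    \<open>bullet T\<close>, leaving \<open>q - 1\<close>; for \<open>k > 0\<close> one of the
    \<open>k\<close> factors \<open>w\<close> is removed.\<close>
  define R where "R = (if k = 0 then [:q - 1:] else (1 + [:q - 1:] * w) * w ^ (k - 1) * P)"
  have S: "S_series T = w * U T" for T
    unfolding U_def w_def by (rule dvd_mult_div_cancel[OF S_series_dvd, symmetric])
  have w0: "w \<noteq> 0" and wev: "poly w e = 0"
    using q_nonzero by (simp_all add: w_def e_def)
  have prod: "(\<Prod>C\<in>root_branches T. [:q:] ^ tree_size (branch T C) * S_series (branch T C)) =
      w ^ k * P"
    by (simp add: S P_def k_def prod.distrib algebra_simps)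
  have pr: "prune (-1) S_series T = w * prune (-1) U T"
    by (simp add: prune_def S sum_distrib_left algebra_simps)
  have bk: "bullet T = (if k = 0 then 1 else (0::Qq poly))"
    by (simp add: bullet_eq_card k_def)
  have P0: "P = 1" if "k = 0" using that finite_root_branches by (simp add: P_def k_def)
  have R: "(1 + [:q - 1:] * w) * (w ^ k * P) - bullet T = w * R"
  proof (cases k)
    case 0
    then show ?thesis by (simp add: R_def bk P0 mult.commute)
  next
    case (Suc m)
    then show ?thesis by (simp add: R_def bk mult.assoc mult.left_commute)
  qed
  have "([:q:] ^ tree_size T - 1) * S_series T =
      prune (-1) S_series T + ((1 + [:q - 1:] * w) * (w ^ k * P) - bullet T)"
    using is_S_S_series unfolding is_S_iff w_def[symmetric] prod[symmetric]
    by (simp only: add_diff_eq)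
  then have "w * (([:q:] ^ tree_size T - 1) * U T) = w * (prune (-1) U T + R)"
    unfolding R pr S by (simp add: algebra_simps)
  \<comment> \<open>\<open>w\<close> is cancelled before evaluating at \<open>e\<close>, where it
    vanishes.\<close>
  then have eq: "([:q:] ^ tree_size T - 1) * U T = prune (-1) U T + R"
    using w0 by simp
  define L where "L = limit_series S_series"
  have L: "poly (U T) e = L T" for T by (simp add: L_def limit_series_def U_def e_def)
  have pruneL: "poly (prune (-1) U T) e = prune (-1) L T"
    unfolding prune_def poly_sum by (intro sum.cong refl) (simp add: L poly_power of_bool_def)
  have PL: "poly P e =
      (\<Prod>C\<in>root_branches T. q ^ tree_size (branch T C) * L (branch T C))"
    by (simp add: P_def poly_prod L poly_power)
  have RL: "poly R e =
      graft_bullet (\<lambda>T. q ^ tree_size T * L T) T + (q - 1) * bullet T"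
  proof -
    \<comment> \<open>The third case means at least two root branches; the remaining factor
      \<open>w ^ (k - 1)\<close> then vanishes at \<open>e\<close>.\<close>
    consider "k = 0" | "k = 1" | "k - 1 \<noteq> 0" by linarith
    then show ?thesis
    proof cases
      case 1
      then show ?thesis by (simp add: R_def graft_bullet_eq bullet_eq_card k_def)
    next
      case 2
      then have "R = (1 + [:q - 1:] * w) * P" by (simp add: R_def)
      then have "poly R e = poly P e" using wev by simp
      then show ?thesis using 2 PL by (simp add: graft_bullet_eq bullet_eq_card k_def)
    next
      case 3
      then have "poly R e = 0" using wev by (simp add: R_def poly_power)
      then show ?thesis using 3 by (simp add: graft_bullet_eq bullet_eq_card k_def)
    qed
  qed
  have "(q ^ tree_size T - 1) * L T = poly (([:q:] ^ tree_size T - 1) * U T) e"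
    by (simp add: L poly_power)
  also have "\<dots> = prune (-1) L T +
      (graft_bullet (\<lambda>T. q ^ tree_size T * L T) T + (q - 1) * bullet T)"
    unfolding eq poly_add pruneL RL ..
  finally show ?thesis by (simp add: linearized_at_def L_def add.assoc)
qed


section \<open>The substitution of 1/q for q\<close>

text \<open>Evaluation at \<open>q\<close> is the embedding of polynomials into fractions, hence
  injective: this is the transcendence of \<open>q\<close>.\<close>

lemma poly_const_q: "poly (map_poly (\<lambda>c. to_fract [:c:]) p) q = to_fract p"
proof (induction p)
  case (pCons a p)
  have "to_fract (pCons a p) = to_fract ([:a:] + [:0, 1:] * p)" by simp
  also have "\<dots> = to_fract [:a:] + q * to_fract p"
    by (simp only: to_fract_add to_fract_mult q_def)
  finally show ?case using pCons.IH by (simp add: map_poly_pCons)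
qed simp

text \<open>Multiplying p(1/q) by \<open>q ^ degree p\<close> gives the reflected polynomial at
  \<open>q\<close>, which is nonzero because \<open>q\<close> is transcendental.\<close>

lemma eval_inv_q_nonzero:
  assumes "p \<noteq> 0"
  shows "eval_inv_q p \<noteq> 0"
proof -
  let ?c = "\<lambda>c::rat. to_fract [:c:]"
  have deg: "degree (map_poly ?c p) = degree p" by (rule degree_map_poly) simp
  have "reflect_poly (map_poly ?c p) = map_poly ?c (reflect_poly p)"
    by (rule poly_eqI) (simp add: coeff_reflect_poly coeff_map_poly deg)
  then have "to_fract (reflect_poly p) = q ^ degree p * eval_inv_q p"
    using poly_reflect_poly_nz[OF q_nonzero, of "map_poly ?c p"] poly_const_q[of "reflect_poly p"]
    by (simp add: deg eval_inv_q_def inverse_eq_divide)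
  moreover have "to_fract (reflect_poly p) \<noteq> 0" using assms by simp
  ultimately show ?thesis by auto
qed

section \<open>Evaluation at 1/q as a ring homomorphism\<close>

lemma eval_inv_q_pCons: "eval_inv_q (pCons a p) = to_fract [:a:] + 1 / q * eval_inv_q p"
  by (simp add: eval_inv_q_def map_poly_pCons)

lemma eval_inv_q_0 [simp]: "eval_inv_q 0 = 0"
  by (simp add: eval_inv_q_def)

lemma eval_inv_q_1 [simp]: "eval_inv_q 1 = 1"
  unfolding one_pCons eval_inv_q_pCons by (simp add: one_pCons[symmetric])

lemma eval_inv_q_add: "eval_inv_q (p + r) = eval_inv_q p + eval_inv_q r"
proof -
  have "to_fract [:a + b:] = to_fract [:a:] + to_fract [:b:]" for a b :: rat
    by (simp flip: to_fract_add)
  then have "map_poly (\<lambda>c. to_fract [:c:]) (p + r) =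
      map_poly (\<lambda>c. to_fract [:c:]) p + map_poly (\<lambda>c. to_fract [:c:]) r"
    by (intro poly_eqI) (simp add: coeff_map_poly)
  then show ?thesis by (simp add: eval_inv_q_def)
qed

lemma eval_inv_q_smult: "eval_inv_q (smult a p) = to_fract [:a:] * eval_inv_q p"
proof (induction p)
  case (pCons b p)
  have "to_fract [:a * b:] = to_fract [:a:] * to_fract [:b:]"
    by (simp flip: to_fract_mult)
  then show ?case using pCons.IH by (simp add: eval_inv_q_pCons algebra_simps)
qed simp

lemma eval_inv_q_mult: "eval_inv_q (p * r) = eval_inv_q p * eval_inv_q r"
  by (induction p)
    (simp_all add: eval_inv_q_add eval_inv_q_smult eval_inv_q_pCons algebra_simps)

text \<open>The definition uses the normalized fraction; cross multiplication shows that every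
  representation gives the same value. Compatibility with sums and products can then be checked on
  arbitrary fractions.\<close>

lemma subst_inv_q_Fract:
  assumes "b \<noteq> 0"
  shows "subst_inv_q (Fract a b) = eval_inv_q a / eval_inv_q b"
proof -
  let ?n = "fst (quot_of_fract (Fract a b))" and ?d = "snd (quot_of_fract (Fract a b))"
  have d: "?d \<noteq> 0" by simp
  have "Fract ?n ?d = Fract a b" by simp
  then have "?n * b = a * ?d" using eq_fract(1)[OF d assms] by blast
  then have "eval_inv_q ?n * eval_inv_q b = eval_inv_q a * eval_inv_q ?d"
    by (metis eval_inv_q_mult)
  then show ?thesis
    using eval_inv_q_nonzero[OF d] eval_inv_q_nonzero[OF assms]
    by (simp add: subst_inv_q_def case_prod_unfold Let_def frac_eq_eq)
qed

lemma subst_inv_q_to_fract: "subst_inv_q (to_fract p) = eval_inv_q p"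
  using subst_inv_q_Fract[of 1 p] by (simp add: to_fract_def)

lemma subst_inv_q_add: "subst_inv_q (x + y) = subst_inv_q x + subst_inv_q y"
proof (cases x; cases y)
  fix a b c d :: "rat poly"
  assume *: "x = Fract a b" "b \<noteq> 0" "y = Fract c d" "d \<noteq> 0"
  then show ?thesis
    using eval_inv_q_nonzero[OF *(2)] eval_inv_q_nonzero[OF *(4)]
    by (simp add: subst_inv_q_Fract eval_inv_q_add eval_inv_q_mult add_frac_eq)
qed

lemma subst_inv_q_mult: "subst_inv_q (x * y) = subst_inv_q x * subst_inv_q y"
proof (cases x; cases y)
  fix a b c d :: "rat poly"
  assume *: "x = Fract a b" "b \<noteq> 0" "y = Fract c d" "d \<noteq> 0"
  then show ?thesis
    by (simp add: subst_inv_q_Fract eval_inv_q_mult)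
qed

lemma subst_inv_q_0 [simp]: "subst_inv_q 0 = 0"
  using subst_inv_q_to_fract[of 0] by simp

lemma subst_inv_q_1 [simp]: "subst_inv_q 1 = 1"
  using subst_inv_q_to_fract[of 1] by simp

lemma subst_inv_q_q: "subst_inv_q q = 1 / q"
  by (simp add: q_def subst_inv_q_to_fract eval_inv_q_pCons flip: one_pCons)

lemma subst_inv_q_diff: "subst_inv_q (x - y) = subst_inv_q x - subst_inv_q y"
  using subst_inv_q_add[of "x - y" y] by simp

lemma subst_inv_q_power: "subst_inv_q (x ^ n) = subst_inv_q x ^ n"
  by (induction n) (simp_all add: subst_inv_q_mult)

lemma subst_inv_q_sum: "subst_inv_q (sum f A) = (\<Sum>x\<in>A. subst_inv_q (f x))"
  by (induction A rule: infinite_finite_induct) (simp_all add: subst_inv_q_add)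

lemma subst_inv_q_prune_1: "subst_inv_q (prune 1 A T) = prune 1 (\<lambda>T. subst_inv_q (A T)) T"
  unfolding prune_def subst_inv_q_sum by (intro sum.cong refl) (simp add: of_bool_def)

lemma subst_inv_q_graft_bullet:
  "subst_inv_q (graft_bullet A T) = graft_bullet (\<lambda>T. subst_inv_q (A T)) T"
  by (simp add: graft_bullet_def)


section \<open>The series Omega\<close>

text \<open>Here the suspended series sits inside \<open>Crls\<close>, so its full trunk supplies
  the factor \<open>q ^ tree_size T\<close>, and the pruned terms carry powers of \<open>q\<close>
  as well.\<close>

lemma is_Omega_iff:
  "is_Omega \<Omega> \<longleftrightarrow> (\<forall>T. (q ^ tree_size T - 1) * \<Omega> T =
    graft_bullet \<Omega> T + (q - 1) * bullet T - prune 1 (\<lambda>T. q ^ tree_size T * \<Omega> T) T)"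
proof -
  have "(bullet :: Qq tree_series) = smul 1 bullet" by (simp add: smul_def)
  then have "Crls A bullet T = A T + prune 1 A T" for A :: "Qq tree_series" and T
    using Crls_smul_bullet[of A 1 T] by simp
  then show ?thesis
    unfolding is_Omega_def smul_Susp smul_def[of "q - 1"] by (simp add: algebra_simps)
qed

lemma is_Omega_Omega_q: "is_Omega Omega_q"
proof -
  have "\<exists>!\<Omega>. is_Omega \<Omega>"
    unfolding is_Omega_iff
  proof (rule ex1_recursive_series_unit[where v = "\<lambda>n. 1 / (q ^ n - 1)"])
    fix n :: nat assume "0 < n"
    then show "1 / (q ^ n - 1) * (q ^ n - 1) = 1"
      using q_power_neq_1[of n] by simp
  next
    fix X Y :: "Qq tree_series" and T
    assume *: "\<And>T'. tree_size T' < tree_size T \<Longrightarrow> X T' = Y T'"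
    have "graft_bullet X T = graft_bullet Y T"
      by (rule graft_bullet_cong[OF *])
    moreover have "prune 1 (\<lambda>T. q ^ tree_size T * X T) T = prune 1 (\<lambda>T. q ^ tree_size T * Y T) T"
      by (rule prune_cong) (simp add: *)
    ultimately show
      "graft_bullet X T + (q - 1) * bullet T - prune 1 (\<lambda>T. q ^ tree_size T * X T) T =
       graft_bullet Y T + (q - 1) * bullet T - prune 1 (\<lambda>T. q ^ tree_size T * Y T) T"
      by simp
  qed
  then show ?thesis unfolding Omega_q_def by (rule theI')
qed

lemma Omega_inv_q_eq:
  "((1 / q) ^ tree_size T - 1) * Omega_inv_q T =
    graft_bullet Omega_inv_q T + (1 / q - 1) * bullet T
    - prune 1 (\<lambda>T. (1 / q) ^ tree_size T * Omega_inv_q T) T"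
proof -
  have "subst_inv_q (bullet T) = bullet T" by (simp add: bullet_def)
  moreover have "subst_inv_q ((q ^ tree_size T - 1) * Omega_q T) =
    subst_inv_q (graft_bullet Omega_q T + (q - 1) * bullet T
      - prune 1 (\<lambda>T. q ^ tree_size T * Omega_q T) T)"
    using is_Omega_Omega_q unfolding is_Omega_iff by simp
  ultimately show ?thesis
    by (simp only: subst_inv_q_add subst_inv_q_diff subst_inv_q_mult subst_inv_q_power
        subst_inv_q_q subst_inv_q_1 subst_inv_q_graft_bullet subst_inv_q_prune_1
        Omega_inv_q_def)
qed

text \<open>Multiply the equation of \<open>\<Omega>\<^bsub>1/q\<^esub>\<close> at a tree with \<open>n\<close> vertices by \<open>- q (-1)\<^sup>n\<^sup>-\<^sup>1\<close>.\<close>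

lemma Omega_bar_linearized: "linearized_at Omega_bar T"
proof -
  let ?W = Omega_inv_q
  obtain a where a: "tree_size T = Suc a"
    using tree_size_pos[of T] gr0_implies_Suc by blast
  define k where "k = - q * (- 1) ^ a"
  have V: "Omega_bar T = (- 1 / q) ^ (tree_size T - 1) * ?W T" for T
    by (simp add: Omega_bar_def Susp_def)
  have 1: "k * (((1 / q) ^ tree_size T - 1) * ?W T) = (q ^ tree_size T - 1) * Omega_bar T"
    using q_nonzero by (simp add: V a k_def field_simps power_minus[of "1 / q"] power_divide)
  have 2: "k * prune 1 (\<lambda>T. (1 / q) ^ tree_size T * ?W T) T = - prune (-1) Omega_bar T"
    unfolding prune_def sum_distrib_left sum_negf[symmetric]
  proof (intro sum.cong refl)
    fix W assume "W \<in> trunks T - {verts (rep_tree T)}"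
    then have "tree_size (trunk T W) < tree_size T" by (rule tree_size_trunk_less)
    moreover obtain b where b: "tree_size (trunk T W) = Suc b"
      using tree_size_pos[of "trunk T W"] gr0_implies_Suc by blast
    \<comment> \<open>\<open>c\<close> is the number of leaves cut off. Of the sign
      \<open>(- 1) ^ a\<close>, the part \<open>(- 1) ^ b\<close> joins the powers of
      \<open>1 / q\<close> to suspend the trunk, and \<open>(- 1) ^ c\<close> becomes the sign in
      \<open>prune (-1)\<close>.\<close>
    ultimately obtain c where c: "a = b + c" using a by (metis Suc_less_eq less_imp_add_positive)
    have kb: "k * (1 / q) ^ Suc b = - ((- 1) ^ c * (- 1 / q) ^ b)"
      using q_nonzero
      by (simp add: k_def c field_simps power_add power_minus[of "1 / q"] power_divide)
    have "k * ((1 / q) ^ Suc b * y) = - ((- 1) ^ c * ((- 1 / q) ^ b * y))" for y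
      unfolding mult.assoc[symmetric] kb by simp
    then show "k * (of_bool (\<forall>C\<in>branches T W. tree_size (branch T C) = 1) *
          1 ^ (tree_size T - tree_size (trunk T W)) *
          ((1 / q) ^ tree_size (trunk T W) * ?W (trunk T W))) =
        - (of_bool (\<forall>C\<in>branches T W. tree_size (branch T C) = 1) *
          (- 1) ^ (tree_size T - tree_size (trunk T W)) * Omega_bar (trunk T W))"
      by (simp add: V a b c of_bool_def del: power_Suc)
  qed
  have 3: "k * graft_bullet ?W T = graft_bullet (\<lambda>T. q ^ tree_size T * Omega_bar T) T"
  proof (cases "card (root_branches T) = 1")
    case True
    then obtain C where C: "root_branches T = {C}" by (auto simp: card_1_singleton_iff)
    \<comment> \<open>The only branch contains every vertex but the root, so its suspension exponent
      is \<open>a - 1\<close>, and \<open>q ^ a * (- 1 / q) ^ (a - 1)\<close> equals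
      \<open>k\<close>.\<close>
    then have "tree_size (branch T C) = a" using sum_tree_size_root_branches[of T] a by simp
    moreover from this obtain b where "a = Suc b"
      using tree_size_pos[of "branch T C"] gr0_implies_Suc by blast
    ultimately show ?thesis
      using C q_nonzero
      by (simp add: graft_bullet_eq V k_def field_simps power_minus[of "1 / q"] power_divide)
  qed (simp add: graft_bullet_eq)
  \<comment> \<open>\<open>bullet T\<close> is nonzero only for \<open>a = 0\<close>, where
    \<open>k = - q\<close>.\<close>
  have 4: "k * ((1 / q - 1) * bullet T) = (q - 1) * bullet T"
    using q_nonzero a by (cases "a = 0") (simp_all add: bullet_eq k_def field_simps)
  have "k * (((1 / q) ^ tree_size T - 1) * ?W T) = k * graft_bullet ?W T +
      k * ((1 / q - 1) * bullet T) - k * prune 1 (\<lambda>T. (1 / q) ^ tree_size T * ?W T) T"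
    unfolding Omega_inv_q_eq by (simp only: distrib_left right_diff_distrib)
  then show ?thesis unfolding 1 2 3 4 linearized_at_def by simp
qed

theorem mainTheorem4:
  shows "(\<forall>T. [:1, q:] dvd S_series T) \<and> limit_series S_series = Omega_bar"
  using S_series_dvd linearized_unique[OF limit_S_series_linearized Omega_bar_linearized]
  by blast

end
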